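(* Let $l\ge4$, $m\ge4$, $a\ge0$ be integers. If $\binom{l+m-6}{l-3}-m+1\ge 0$, then $$f\!\left(l,m,\tbinom{l+m-6}{l-3}-m+1,\,a\right)>f(l,m),$$ and if $\binom{l+m-6}{m-3}-l+1\ge0$, then $$f\!\left(l,m,\,a,\tbinom{l+m-6}{m-3}-l+1\right)>f(l,m),$$ where $f(l,m)=\binom{l+m-4}{l-2}+1$. Here an inequality $F>f(l,m)$ means that there is a set $\mathcal X$ as below with at least $f(l,m)$ points that contains no $l$-cup with at most the stated number of points inside and no $m$-cap with at most the stated number of points inside (in particular it holds if $F$ does not exist).
   Context: Fix Cartesian coordinates $(x,y)$ in the plane. Let $\mathcal X$ be a finite set of points in general position (no three collinear) with pairwise distinct $x$-coordinates. A subset $\{(x_{1},y_{1}),\dots,(x_{r},y_{r})\}$ with $x_1<\dots<x_r$ is an $r$-cup if the slopes $\frac{y_{j+1}-y_j}{x_{j+1}-x_j}$, $j=1,\dots,r-1$, are strictly increasing in $j$, and an $r$-cap if they are strictly decreasing. The points of $\mathcal X$ inside a cup or cap are the points of $\mathcal X$ lying in the interior of the convex hull of the cup or cap. $f(l,m)$ is the least positive integer such that every such set with at least $f(l,m)$ points contains an $l$-cup or an $m$-cap; by Erdős–Szekeres, $f(l,m)=\binom{l+m-4}{l-2}+1$. $f(l,m,l_1,m_1)$ is the least positive integer (if it exists) such that every such set $\mathcal X$ with at least $f(l,m,l_1,m_1)$ points contains an $l$-cup with at most $l_1$ points of $\mathcal X$ inside or an $m$-cap with at most $m_1$ points of $\mathcal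 X$ inside. *)

theory Defs
  imports "HOL-Analysis.Analysis"
begin

definition slope :: "real \<times> real \<Rightarrow> real \<times> real \<Rightarrow> real" where
  "slope p q = (snd q - snd p) / (fst q - fst p)"

definition admissible :: "(real \<times> real) set \<Rightarrow> bool" where
  "admissible X \<longleftrightarrow> finite X \<and> inj_on fst X \<and>
     (\<forall>p\<in>X. \<forall>q\<in>X. \<forall>r\<in>X. p \<noteq> q \<and> p \<noteq> r \<and> q \<noteq> r \<longrightarrow> \<not> collinear {p, q, r})"

definition is_cup :: "nat \<Rightarrow> (real \<times> real) set \<Rightarrow> bool" where
  "is_cup r C \<longleftrightarrow> (\<exists>ps. set ps = C \<and> length ps = r \<and> sorted_wrt (\<lambda>p q. fst p < fst q) ps \<and>
     (\<forall>j. j + 2 < r \<longrightarrow> slope (ps!j) (ps!(j+1)) < slope (ps!(j+1)) (ps!(j+2))))"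

definition is_cap :: "nat \<Rightarrow> (real \<times> real) set \<Rightarrow> bool" where
  "is_cap r C \<longleftrightarrow> (\<exists>ps. set ps = C \<and> length ps = r \<and> sorted_wrt (\<lambda>p q. fst p < fst q) ps \<and>
     (\<forall>j. j + 2 < r \<longrightarrow> slope (ps!j) (ps!(j+1)) > slope (ps!(j+1)) (ps!(j+2))))"

definition points_inside :: "(real \<times> real) set \<Rightarrow> (real \<times> real) set \<Rightarrow> nat" where
  "points_inside X C = card {p \<in> X. p \<in> interior (convex hull C)}"

definition avoids :: "(real \<times> real) set \<Rightarrow> nat \<Rightarrow> nat \<Rightarrow> int \<Rightarrow> int \<Rightarrow> bool" where
  "avoids X l m l1 m1 \<longleftrightarrow>
     \<not> (\<exists>C\<subseteq>X. is_cup l C \<and> int (points_inside X C) \<le> l1) \<and>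
     \<not> (\<exists>C\<subseteq>X. is_cap m C \<and> int (points_inside X C) \<le> m1)"

definition fES :: "nat \<Rightarrow> nat \<Rightarrow> nat" where
  "fES l m = ((l + m - 4) choose (l - 2)) + 1"

end

theory Submission
  imports Defs
begin

text \<open>Call an Erdos--Szekeres set \<open>X(l, m)\<close> a largest set without \<open>l\<close>-cup and \<open>m\<close>-cap.
  Place \<open>P = X(l-2, m)\<close>, \<open>Q = X(l-1, m-1)\<close> and \<open>B = X(l, m-1)\<close> from left to right, each very high
  above the previous ones; their union is again an \<open>X(l, m)\<close>. Here \<open>Q\<close> is built by the
  left-right mirror image of the Erdos--Szekeres recursion, so that its rightmost \<open>m - 2\<close> points
  form a cap whose first point \<open>q\<close> is the right end of no \<open>(l-2)\<close>-cup of \<open>Q\<close>. Double \<open>q\<close>: add a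
  point \<open>q'\<close> extremely close to \<open>q\<close> such that the slope of \<open>q q'\<close> exceeds all slopes in \<open>P \<union> Q\<close>
  but not those from there to \<open>B\<close>. This creates no \<open>m\<close>-cap, and every \<open>l\<close>-cup consists of a cup in
  \<open>P \<union> Q\<close> that starts in \<open>P\<close> and ends in \<open>q\<close>, followed by \<open>q'\<close> and one point of \<open>B\<close>. Every point of
  \<open>Q\<close> left of \<open>q\<close> lies inside such a cup, and at most \<open>m - 2\<close> points of \<open>Q\<close> are not left of \<open>q\<close>.
  The second inequality follows by reflection in the \<open>x\<close>-axis.\<close>

section \<open>Orientation, cups and caps\<close>

text \<open>Twice the signed area of the triangle, positive for a left turn. Being polynomial in the
  coordinates, it can be studied by limits and without division.\<close>

definition orient :: "real \<times> real \<Rightarrow> real \<times> real \<Rightarrow> real \<times> real \<Rightarrow> real" where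
  "orient p q r = (fst q - fst p) * (snd r - snd p) - (snd q - snd p) * (fst r - fst p)"

text \<open>Quantifying over all triples instead of consecutive ones makes the property hereditary
  and removes the list from the definition.\<close>

definition cup :: "(real \<times> real) set \<Rightarrow> bool" where
  "cup C \<longleftrightarrow> (\<forall>p\<in>C. \<forall>q\<in>C. \<forall>r\<in>C. fst p < fst q \<longrightarrow> fst q < fst r \<longrightarrow> 0 < orient p q r)"

definition cap :: "(real \<times> real) set \<Rightarrow> bool" where
  "cap C \<longleftrightarrow> (\<forall>p\<in>C. \<forall>q\<in>C. \<forall>r\<in>C. fst p < fst q \<longrightarrow> fst q < fst r \<longrightarrow> orient p q r < 0)"

definition generic :: "(real \<times> real) set \<Rightarrow> bool" where
  "generic X \<longleftrightarrow> finite X \<and> inj_on fst X \<and>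
     (\<forall>p\<in>X. \<forall>q\<in>X. \<forall>r\<in>X. fst p < fst q \<longrightarrow> fst q < fst r \<longrightarrow> orient p q r \<noteq> 0)"

definition cups_le :: "nat \<Rightarrow> (real \<times> real) set \<Rightarrow> bool" where
  "cups_le n X \<longleftrightarrow> (\<forall>C\<subseteq>X. cup C \<longrightarrow> card C \<le> n)"

definition caps_le :: "nat \<Rightarrow> (real \<times> real) set \<Rightarrow> bool" where
  "caps_le n X \<longleftrightarrow> (\<forall>C\<subseteq>X. cap C \<longrightarrow> card C \<le> n)"

lemma cup_subset: "cup C \<Longrightarrow> D \<subseteq> C \<Longrightarrow> cup D"
  unfolding cup_def by blast

lemma cap_subset: "cap C \<Longrightarrow> D \<subseteq> C \<Longrightarrow> cap D"
  unfolding cap_def by blast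

lemma orient_rotate: "orient p q r = orient q r p"
  unfolding orient_def by (simp add: algebra_simps)

lemma orient_swap: "orient p r q = - orient p q r"
  unfolding orient_def by (simp add: algebra_simps)

lemma collinear_imp_orient_eq_0:
  assumes "collinear {p, q, r}"
  shows "orient p q r = 0"
proof -
  obtain u where u: "\<And>x y. x \<in> {p, q, r} \<Longrightarrow> y \<in> {p, q, r} \<Longrightarrow> \<exists>c. x - y = c *\<^sub>R u"
    using assms unfolding collinear_def by blast
  obtain c where c: "q - p = c *\<^sub>R u" using u[of q p] by auto
  obtain d where d: "r - p = d *\<^sub>R u" using u[of r p] by auto
  have "fst q - fst p = c * fst u" "snd q - snd p = c * snd u"
    "fst r - fst p = d * fst u" "snd r - snd p = d * snd u"
    using arg_cong[OF c, of fst] arg_cong[OF c, of snd] arg_cong[OF d, of fst] arg_cong[OF d, of snd]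
    by simp_all
  then show ?thesis unfolding orient_def by simp
qed

text \<open>Sorting three points by abscissa permutes the arguments of \<open>orient\<close>, which
  changes at most its sign.\<close>

lemma generic_orient_neq_0:
  assumes X: "generic X" and "p \<in> X" "q \<in> X" "r \<in> X" "p \<noteq> q" "p \<noteq> r" "q \<noteq> r"
  shows "orient p q r \<noteq> 0"
proof -
  have sorted: "fst p < fst q \<Longrightarrow> fst q < fst r \<Longrightarrow> orient p q r \<noteq> 0"
    if "p \<in> X" "q \<in> X" "r \<in> X" for p q r
    using X that unfolding generic_def by blast
  have ne: "fst p \<noteq> fst q" "fst p \<noteq> fst r" "fst q \<noteq> fst r"
    using assms unfolding generic_def by (auto dest: inj_onD)
  have perm: "orient p r q = - orient p q r" "orient q p r = - orient p q r" "orient q r p = orient p q r"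
    "orient r p q = orient p q r" "orient r q p = - orient p q r"
    by (simp_all add: orient_def algebra_simps)
  consider "fst p < fst q" "fst q < fst r" | "fst p < fst r" "fst r < fst q" | "fst q < fst p" "fst p < fst r"
    | "fst q < fst r" "fst r < fst p" | "fst r < fst p" "fst p < fst q" | "fst r < fst q" "fst q < fst p"
    using ne by linarith
  then show ?thesis
    using assms(2-4) sorted perm by cases (metis neg_equal_0_iff_equal)+
qed

lemma generic_imp_admissible:
  assumes "generic X"
  shows "admissible X"
  using assms generic_orient_neq_0[OF assms] collinear_imp_orient_eq_0
  unfolding admissible_def generic_def by metis

section \<open>From slopes of consecutive edges to orientations of all triples\<close>

lemma slope_less_iff_orient:
  assumes "fst p < fst q" "fst q < fst r"
  shows "slope p q < slope q r \<longleftrightarrow> 0 < orient p q r"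
  using assms unfolding slope_def orient_def by (simp add: field_simps)

text \<open>Only consecutive triples are constrained in the definition of a cup; the slope of a chord
  is a weighted mean of the slopes of the edges it spans.\<close>

lemma slope_between_left:
  assumes "fst p < fst q" "fst q < fst r" "slope p q \<le> slope q r"
  shows "slope p r \<le> slope q r"
  using assms unfolding slope_def by (simp add: field_simps)

lemma slope_between_right:
  assumes "fst p < fst q" "fst q < fst r" "slope p q \<le> slope q r"
  shows "slope p q \<le> slope p r"
  using assms unfolding slope_def by (simp add: field_simps)

text \<open>Compare at the middle vertex: the chord ending there is at most as steep as the edge
  just before it, and the chord starting there at least as steep as the edge just after it.\<close>

lemma sorted_slopes_imp_triple:
  assumes sorted: "sorted_wrt (\<lambda>p q. fst p < fst q) ps"
    and step: "\<And>j. j + 2 < length ps \<Longrightarrow> slope (ps!j) (ps!(j+1)) < slope (ps!(j+1)) (ps!(j+2))"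
    and ijk: "i < j" "j < k" "k < length ps"
  shows "slope (ps!i) (ps!j) < slope (ps!j) (ps!k)"
proof -
  have less: "fst (ps!a) < fst (ps!b)" if "a < b" "b < length ps" for a b
    using sorted_wrt_nth_less[OF sorted that] .
  have left: "slope (ps!a) (ps!(Suc (a + n))) \<le> slope (ps!(a+n)) (ps!(Suc (a + n)))"
    if "Suc (a + n) < length ps" for a n
    using that
  proof (induction n)
    case (Suc n)
    show ?case
      using Suc step[of "a + n"] less[of a "Suc (a + n)"] less[of "Suc (a + n)" "Suc (Suc (a + n))"]
      by (intro slope_between_left) auto
  qed simp
  have right: "slope (ps!a) (ps!Suc a) \<le> slope (ps!a) (ps!b)" if "a < b" "b < length ps" for a b
    using that
  proof (induction "b - a" arbitrary: a)
    case (Suc n)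
    show ?case
    proof (cases "b = Suc a")
      case False
      then have "slope (ps!Suc a) (ps!Suc (Suc a)) \<le> slope (ps!Suc a) (ps!b)"
        using Suc by (intro Suc.hyps(1)) auto
      then show ?thesis
        using Suc.prems False step[of a] less[of a "Suc a"] less[of "Suc a" b]
        by (intro slope_between_right) auto
    qed simp
  qed simp
  have "slope (ps!i) (ps!j) \<le> slope (ps!(j-1)) (ps!j)"
    using left[of i "j - 1 - i"] ijk by simp
  also have "\<dots> < slope (ps!j) (ps!Suc j)"
    using step[of "j-1"] ijk by (simp add: numeral_2_eq_2)
  also have "\<dots> \<le> slope (ps!j) (ps!k)"
    using right[of j k] ijk by simp
  finally show ?thesis .
qed

lemma sorted_wrt_fst_less_nth:
  fixes ps :: "(real \<times> real) list"
  assumes sorted: "sorted_wrt (\<lambda>p q. fst p < fst q) ps"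
    and "i < length ps" "j < length ps" "fst (ps!i) < fst (ps!j)"
  shows "i < j"
  using sorted_wrt_nth_less[OF sorted, of j i] assms by (metis less_asym linorder_neqE_nat)

lemma sorted_wrt_fst_distinct:
  fixes ps :: "(real \<times> real) list"
  assumes "sorted_wrt (\<lambda>p q. fst p < fst q) ps"
  shows "distinct ps"
  using assms by (induction ps) auto

lemma is_cup_imp_cup:
  assumes "is_cup r C"
  shows "cup C" "card C = r"
proof -
  obtain ps where ps: "set ps = C" "length ps = r" "sorted_wrt (\<lambda>p q. fst p < fst q) ps"
    and step: "\<forall>j. j + 2 < r \<longrightarrow> slope (ps!j) (ps!(j+1)) < slope (ps!(j+1)) (ps!(j+2))"
    using assms unfolding is_cup_def by blast
  show "card C = r"
    using ps distinct_card[OF sorted_wrt_fst_distinct[OF ps(3)]] by simp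
  show "cup C"
    unfolding cup_def
  proof (intro ballI impI)
    fix p q s assume "p \<in> C" "q \<in> C" "s \<in> C" and less: "fst p < fst q" "fst q < fst s"
    then obtain i j k where ijk: "p = ps!i" "q = ps!j" "s = ps!k" "i < r" "j < r" "k < r"
      using ps(1,2) by (metis in_set_conv_nth)
    have "i < j" "j < k"
      using sorted_wrt_fst_less_nth[OF ps(3)] ijk less ps(2) by blast+
    then have "slope p q < slope q s"
      using sorted_slopes_imp_triple[OF ps(3)] step ijk ps(2) by blast
    then show "0 < orient p q s"
      using slope_less_iff_orient[OF less] by simp
  qed
qed

section \<open>Reflections and translations\<close>

definition flip :: "real \<times> real \<Rightarrow> real \<times> real" where
  "flip p = (fst p, - snd p)"

definition mirror :: "real \<times> real \<Rightarrow> real \<times> real" where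
  "mirror p = (- fst p, snd p)"

lemma fst_flip [simp]: "fst (flip p) = fst p"
  by (simp add: flip_def)

lemma fst_mirror [simp]: "fst (mirror p) = - fst p"
  by (simp add: mirror_def)

lemma flip_flip [simp]: "flip (flip p) = p"
  by (simp add: flip_def)

lemma mirror_mirror [simp]: "mirror (mirror p) = p"
  by (simp add: mirror_def)

lemma inj_flip: "inj_on flip X"
  by (metis flip_flip inj_onI)

lemma inj_mirror: "inj_on mirror X"
  by (metis mirror_mirror inj_onI)

lemma orient_flip: "orient (flip p) (flip q) (flip r) = - orient p q r"
  by (simp add: orient_def flip_def algebra_simps)

lemma orient_mirror: "orient (mirror p) (mirror q) (mirror r) = orient r q p"
  by (simp add: orient_def mirror_def algebra_simps)

lemma orient_translate: "orient (c + p) (c + q) (c + r) = orient p q r"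
  by (simp add: orient_def algebra_simps)

lemma cup_flip: "cup (flip ` C) \<longleftrightarrow> cap C"
  unfolding cup_def cap_def by (simp add: orient_flip)

lemma cap_flip: "cap (flip ` C) \<longleftrightarrow> cup C"
  unfolding cup_def cap_def by (simp add: orient_flip)

text \<open>The reflection reverses both the left-right order and the orientation, and the two
  effects cancel.\<close>

lemma cup_mirror: "cup (mirror ` C) \<longleftrightarrow> cup C"
  unfolding cup_def by (simp add: orient_mirror) blast

lemma cap_mirror: "cap (mirror ` C) \<longleftrightarrow> cap C"
  unfolding cap_def by (simp add: orient_mirror) blast

lemma cup_translate: "cup ((+) c ` C) \<longleftrightarrow> cup C"
  unfolding cup_def by (simp add: orient_translate)

lemma cap_translate: "cap ((+) c ` C) \<longleftrightarrow> cap C"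
  unfolding cap_def by (simp add: orient_translate)

lemma is_cap_imp_cap:
  assumes "is_cap r C"
  shows "cap C" "card C = r"
proof -
  obtain ps where ps: "set ps = C" "length ps = r" "sorted_wrt (\<lambda>p q. fst p < fst q) ps"
    and step: "\<forall>j. j + 2 < r \<longrightarrow> slope (ps!j) (ps!(j+1)) > slope (ps!(j+1)) (ps!(j+2))"
    using assms unfolding is_cap_def by blast
  have slope_flip: "slope (flip p) (flip q) = - slope p q" for p q
    by (simp add: slope_def flip_def minus_divide_left)
  have "is_cup r (flip ` C)"
    unfolding is_cup_def
    using ps step by (intro exI[of _ "map flip ps"]) (auto simp: sorted_wrt_map slope_flip)
  then show "cap C" "card C = r"
    using is_cup_imp_cup[of r "flip ` C"] by (simp_all add: cup_flip card_image inj_flip)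
qed

lemma generic_flip: "generic X \<Longrightarrow> generic (flip ` X)"
  unfolding generic_def by (auto simp: orient_flip inj_on_def)

lemma generic_mirror: "generic X \<Longrightarrow> generic (mirror ` X)"
  unfolding generic_def by (simp add: orient_mirror inj_on_def) blast

lemma generic_translate: "generic X \<Longrightarrow> generic ((+) c ` X)"
  unfolding generic_def by (simp add: orient_translate inj_on_def)

lemma cups_le_mirror: "cups_le n X \<Longrightarrow> cups_le n (mirror ` X)"
  unfolding cups_le_def by (metis card_image cup_mirror inj_mirror subset_image_iff)

lemma caps_le_mirror: "caps_le n X \<Longrightarrow> caps_le n (mirror ` X)"
  unfolding caps_le_def by (metis card_image cap_mirror inj_mirror subset_image_iff)

lemma cups_le_translate: "cups_le n X \<Longrightarrow> cups_le n ((+) c ` X)"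
  unfolding cups_le_def by (metis card_image cup_translate inj_on_add subset_image_iff)

lemma caps_le_translate: "caps_le n X \<Longrightarrow> caps_le n ((+) c ` X)"
  unfolding caps_le_def by (metis card_image cap_translate inj_on_add subset_image_iff)

section \<open>Placing one set steeply above another\<close>

text \<open>\<open>B\<close> lies to the right of \<open>A\<close>, above every line through two
  points of \<open>A\<close>, and every line through two points of \<open>B\<close> passes above
  \<open>A\<close>. So two points of \<open>A\<close> and one of \<open>B\<close> form a cup, one of
  \<open>A\<close> and two of \<open>B\<close> a cap.\<close>

definition steep :: "(real \<times> real) set \<Rightarrow> (real \<times> real) set \<Rightarrow> bool" where
  "steep A B \<longleftrightarrow> (\<forall>a\<in>A. \<forall>b\<in>B. fst a < fst b \<and>
     (\<forall>a'\<in>A. fst a < fst a' \<longrightarrow> 0 < orient a a' b) \<and>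
     (\<forall>b'\<in>B. fst b < fst b' \<longrightarrow> orient a b b' < 0))"

lemma steep_less: "steep A B \<Longrightarrow> a \<in> A \<Longrightarrow> b \<in> B \<Longrightarrow> fst a < fst b"
  unfolding steep_def by blast

lemma steep_cup:
  "steep A B \<Longrightarrow> a \<in> A \<Longrightarrow> a' \<in> A \<Longrightarrow> b \<in> B \<Longrightarrow> fst a < fst a' \<Longrightarrow> 0 < orient a a' b"
  unfolding steep_def by blast

lemma steep_cap:
  "steep A B \<Longrightarrow> a \<in> A \<Longrightarrow> b \<in> B \<Longrightarrow> b' \<in> B \<Longrightarrow> fst b < fst b' \<Longrightarrow> orient a b b' < 0"
  unfolding steep_def by blast

lemma steep_disjoint: "steep A B \<Longrightarrow> A \<inter> B = {}"
  using steep_less by fastforce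

lemma eventually_affine_pos:
  fixes c d :: real
  assumes "0 < c"
  shows "\<forall>\<^sub>F v in at_top. 0 < c * v + d"
  using eventually_gt_at_top[of "- d / c"]
  by eventually_elim (use assms in \<open>simp add: field_simps\<close>)

text \<open>Shift \<open>B\<close> past the right end of \<open>A\<close> by a fixed
  \<open>u\<close>, then raise it by \<open>v\<close>. Every orientation in question is affine in
  \<open>v\<close>, with the required sign of the leading coefficient, so large \<open>v\<close>
  works for the finitely many triples.\<close>

lemma exists_steep_translate:
  assumes A: "finite A" and B: "finite B"
  shows "\<exists>c. steep A ((+) c ` B)"
proof -
  obtain M where M: "\<And>a. a \<in> A \<Longrightarrow> fst a \<le> M"
    using bdd_above_finite[OF finite_imageI[OF A, of fst]] unfolding bdd_above_def by auto
  obtain L where L: "\<And>b. b \<in> B \<Longrightarrow> L \<le> fst b"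
    using bdd_below_finite[OF finite_imageI[OF B, of fst]] unfolding bdd_below_def by auto
  define u where "u = M - L + 1"
  have u: "fst a < fst b + u" if "a \<in> A" "b \<in> B" for a b
    using M[OF that(1)] L[OF that(2)] unfolding u_def by linarith
  have "\<forall>\<^sub>F v in at_top. fst a < fst a' \<longrightarrow> 0 < orient a a' ((u, v) + b)" for a a' b
  proof (cases "fst a < fst a'")
    case True
    then have "\<forall>\<^sub>F v in at_top. 0 < (fst a' - fst a) * v + orient a a' ((u, 0) + b)"
      by (intro eventually_affine_pos) simp
    then show ?thesis
      by eventually_elim (simp add: orient_def algebra_simps)
  qed simp
  then have 1: "\<forall>\<^sub>F v in at_top. \<forall>a\<in>A. \<forall>a'\<in>A. \<forall>b\<in>B. fst a < fst a' \<longrightarrow> 0 < orient a a' ((u, v) + b)"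
    using A B by (intro eventually_ball_finite ballI) auto
  have "\<forall>\<^sub>F v in at_top. fst b < fst b' \<longrightarrow> orient a ((u, v) + b) ((u, v) + b') < 0" for a b b'
  proof (cases "fst b < fst b'")
    case True
    then have "\<forall>\<^sub>F v in at_top. 0 < (fst b' - fst b) * v - orient a ((u, 0) + b) ((u, 0) + b')"
      using eventually_affine_pos[of "fst b' - fst b" "- orient a ((u, 0) + b) ((u, 0) + b')"] by simp
    then show ?thesis
      by eventually_elim (simp add: orient_def algebra_simps)
  qed simp
  then have 2: "\<forall>\<^sub>F v in at_top. \<forall>a\<in>A. \<forall>b\<in>B. \<forall>b'\<in>B. fst b < fst b' \<longrightarrow>
      orient a ((u, v) + b) ((u, v) + b') < 0"
    using A B by (intro eventually_ball_finite ballI) auto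
  obtain v where v: "\<forall>a\<in>A. \<forall>a'\<in>A. \<forall>b\<in>B. fst a < fst a' \<longrightarrow> 0 < orient a a' ((u, v) + b)"
      "\<forall>a\<in>A. \<forall>b\<in>B. \<forall>b'\<in>B. fst b < fst b' \<longrightarrow> orient a ((u, v) + b) ((u, v) + b') < 0"
    using eventually_happens[OF eventually_conj[OF 1 2]] by auto
  have "steep A ((+) (u, v) ` B)"
    unfolding steep_def using u v by (auto simp: add.commute)
  then show ?thesis ..
qed

lemma generic_steep_Un:
  assumes A: "generic A" and B: "generic B" and s: "steep A B"
  shows "generic (A \<union> B)"
proof -
  have "orient p q r \<noteq> 0" if pqr: "p \<in> A \<union> B" "q \<in> A \<union> B" "r \<in> A \<union> B" "fst p < fst q" "fst q < fst r"
    for p q r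
  proof -
    \<comment> \<open>A triple sorted by abscissa cannot return from \<open>B\<close> to
      \<open>A\<close>, which leaves four patterns.\<close>
    have BA: "\<not> (x \<in> B \<and> y \<in> A \<and> fst x < fst y)" for x y
      using steep_less[OF s, of y x] by auto
    consider "p \<in> A" "q \<in> A" "r \<in> A" | "p \<in> A" "q \<in> A" "r \<in> B" | "p \<in> A" "q \<in> B" "r \<in> B"
      | "p \<in> B" "q \<in> B" "r \<in> B"
      using pqr BA[of p q] BA[of q r] by blast
    then show ?thesis
      using pqr A B steep_cup[OF s, of p q r] steep_cap[OF s, of p q r] unfolding generic_def
      by cases force+
  qed
  moreover have "inj_on fst (A \<union> B)"
    using A B steep_less[OF s] unfolding generic_def by (subst inj_on_Un) fastforce
  ultimately show ?thesis
    using A B unfolding generic_def by blast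
qed

section \<open>Cups and caps in a steep union\<close>

lemma card_le_1_if_no_two:
  assumes "finite S" and "inj_on fst S"
    and "\<And>x y. x \<in> S \<Longrightarrow> y \<in> S \<Longrightarrow> \<not> fst x < (fst y :: real)"
  shows "card S \<le> 1"
proof -
  have "x = y" if "x \<in> S" "y \<in> S" for x y
  proof -
    have "fst x = fst y" using assms(3)[of x y] assms(3)[of y x] that by linarith
    then show ?thesis using inj_onD[OF assms(2)] that by blast
  qed
  then show ?thesis
    using assms(1) by (simp add: card_le_Suc0_iff_eq)
qed

text \<open>A second point of \<open>B\<close> would form a cap with \<open>a\<close> and the first
  one.\<close>

lemma cup_meets_upper:
  assumes s: "steep A B" and B: "generic B" and C: "cup C" and a: "a \<in> C" "a \<in> A"
  shows "card (C \<inter> B) \<le> 1"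
proof (rule card_le_1_if_no_two)
  show "finite (C \<inter> B)" "inj_on fst (C \<inter> B)"
    using B unfolding generic_def by (auto intro: inj_on_subset)
  fix x y assume xy: "x \<in> C \<inter> B" "y \<in> C \<inter> B"
  show "\<not> fst x < fst y"
    using steep_cap[OF s a(2), of x y] steep_less[OF s a(2), of x] C a xy
    unfolding cup_def by fastforce
qed

lemma cap_meets_lower:
  assumes s: "steep A B" and A: "generic A" and C: "cap C" and b: "b \<in> C" "b \<in> B"
  shows "card (C \<inter> A) \<le> 1"
proof (rule card_le_1_if_no_two)
  show "finite (C \<inter> A)" "inj_on fst (C \<inter> A)"
    using A unfolding generic_def by (auto intro: inj_on_subset)
  fix x y assume xy: "x \<in> C \<inter> A" "y \<in> C \<inter> A"
  show "\<not> fst x < fst y"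
    using steep_cup[OF s, of x y b] steep_less[OF s _ b(2), of y] C b xy
    unfolding cap_def by fastforce
qed

lemma card_split:
  assumes "finite A" "finite B" "C \<subseteq> A \<union> B"
  shows "card C \<le> card (C \<inter> A) + card (C \<inter> B)"
  using assms by (metis Int_Un_distrib card_Un_le inf.absorb1)

text \<open>A cup that is not inside \<open>B\<close> has at most one point of \<open>B\<close> on
  top of its part in \<open>A\<close>; hence the bound for \<open>A\<close> may be only one below
  that for \<open>B\<close>.\<close>

lemma cups_le_steep_Un:
  assumes s: "steep A B" and A: "generic A" and B: "generic B"
    and "cups_le n A" "cups_le (Suc n) B"
  shows "cups_le (Suc n) (A \<union> B)"
  unfolding cups_le_def
proof (intro allI impI)
  fix C assume C: "C \<subseteq> A \<union> B" "cup C"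
  show "card C \<le> Suc n"
  proof (cases "C \<subseteq> B")
    case True
    then show ?thesis using assms C unfolding cups_le_def by blast
  next
    case False
    then obtain a where "a \<in> C" "a \<in> A" using C by blast
    then have "card (C \<inter> B) \<le> 1" using cup_meets_upper[OF s B C(2)] by blast
    moreover have "card (C \<inter> A) \<le> n"
      using assms(4) cup_subset[OF C(2), of "C \<inter> A"] unfolding cups_le_def by blast
    ultimately show ?thesis
      using card_split[OF _ _ C(1)] A B unfolding generic_def by force
  qed
qed

lemma caps_le_steep_Un:
  assumes s: "steep A B" and A: "generic A" and B: "generic B"
    and "caps_le (Suc n) A" "caps_le n B"
  shows "caps_le (Suc n) (A \<union> B)"
  unfolding caps_le_def
proof (intro allI impI)
  fix C assume C: "C \<subseteq> A \<union> B" "cap C"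
  show "card C \<le> Suc n"
  proof (cases "C \<subseteq> A")
    case True
    then show ?thesis using assms C unfolding caps_le_def by blast
  next
    case False
    then obtain b where "b \<in> C" "b \<in> B" using C by blast
    then have "card (C \<inter> A) \<le> 1" using cap_meets_lower[OF s A C(2)] by blast
    moreover have "card (C \<inter> B) \<le> n"
      using assms(5) cap_subset[OF C(2), of "C \<inter> B"] unfolding caps_le_def by blast
    ultimately show ?thesis
      using card_split[OF _ _ C(1)] A B unfolding generic_def by force
  qed
qed

section \<open>Erdos--Szekeres sets\<close>

text \<open>In the notation of the paper, \<open>i = l - 2\<close> and \<open>j = m - 2\<close>.\<close>

definition es_set :: "nat \<Rightarrow> nat \<Rightarrow> (real \<times> real) set \<Rightarrow> bool" where
  "es_set i j X \<longleftrightarrow> generic X \<and> card X = ((i + j) choose i) \<and>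
     cups_le (Suc i) X \<and> caps_le (Suc j) X"

lemma es_set_translate: "es_set i j X \<Longrightarrow> es_set i j ((+) c ` X)"
  unfolding es_set_def
  by (simp add: generic_translate cups_le_translate caps_le_translate card_image)

lemma es_set_mirror: "es_set i j X \<Longrightarrow> es_set i j (mirror ` X)"
  unfolding es_set_def
  by (simp add: generic_mirror cups_le_mirror caps_le_mirror card_image inj_mirror)

lemma es_set_singleton:
  assumes "i = 0 \<or> j = 0"
  shows "es_set i j {p}"
proof -
  have "card C \<le> 1" if "C \<subseteq> {p}" for C
    using card_mono[OF _ that] by simp
  then have "cups_le (Suc i) {p}" "caps_le (Suc j) {p}"
    unfolding cups_le_def caps_le_def by (metis One_nat_def Suc_le_mono le_trans zero_le)+
  then show ?thesis
    using assms unfolding es_set_def generic_def by auto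
qed

text \<open>The Erdos--Szekeres recursion; the cardinalities add up by Pascal's rule.\<close>

lemma es_set_steep_Un:
  assumes s: "steep A B" and A: "es_set i (Suc j) A" and B: "es_set (Suc i) j B"
  shows "es_set (Suc i) (Suc j) (A \<union> B)"
proof -
  have "card (A \<union> B) = card A + card B"
    using A B steep_disjoint[OF s] unfolding es_set_def generic_def by (intro card_Un_disjoint) auto
  then show ?thesis
    using assms generic_steep_Un[OF _ _ s] cups_le_steep_Un[OF s] caps_le_steep_Un[OF s]
    unfolding es_set_def by simp
qed

lemma exists_steep_es_set:
  assumes "finite A" and "\<exists>B. es_set i j B"
  shows "\<exists>B. es_set i j B \<and> steep A B"
proof -
  obtain B where B: "es_set i j B" using assms by blast
  then have "finite B" unfolding es_set_def generic_def by blast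
  then show ?thesis
    using exists_steep_translate[OF assms(1)] es_set_translate[OF B] by blast
qed

lemma exists_es_set: "\<exists>X. es_set i j X"
proof (induction i arbitrary: j)
  case 0
  then show ?case using es_set_singleton by blast
next
  case (Suc i)
  show ?case
  proof (induction j)
    case 0
    then show ?case using es_set_singleton by blast
  next
    case (Suc j)
    \<comment> \<open>The lower set comes from the outer induction hypothesis, which covers every
      second index; the upper set comes from the inner one.\<close>
    obtain A where A: "es_set i (Suc j) A" using \<open>\<And>j. \<exists>X. es_set i j X\<close> by blast
    then have "finite A" unfolding es_set_def generic_def by blast
    then show ?case using exists_steep_es_set[OF _ Suc] es_set_steep_Un[OF _ A] by blast
  qed
qed

text \<open>Cups of \<open>X\<close> may have \<open>i + 2\<close> points, but those starting at
  \<open>q\<close> have one less. In the induction on \<open>i\<close> the point \<open>q\<close>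
  stays fixed while sets are stacked above: each adds at most one point to a cup from
  \<open>q\<close> and none to the left of \<open>q\<close>.\<close>

lemma exists_es_set_short_cups_from_point:
  "\<exists>X q. es_set (Suc i) (Suc j) X \<and> q \<in> X \<and>
     (\<forall>C\<subseteq>X. cup C \<longrightarrow> q \<in> C \<longrightarrow> (\<forall>p\<in>C. fst q \<le> fst p) \<longrightarrow> card C \<le> Suc i) \<and>
     card {p\<in>X. fst p \<le> fst q} \<le> j + 2"
proof (induction i)
  case 0
  obtain X where X: "es_set (Suc 0) (Suc j) X" using exists_es_set by blast
  then have fin: "finite X" and card: "card X = j + 2" and inj: "inj_on fst X"
    unfolding es_set_def generic_def by auto
  have "X \<noteq> {}" using card by auto
  \<comment> \<open>Here \<open>X\<close> has only \<open>j + 2\<close> points, and \<open>q\<close>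
    is the rightmost one, so the only cup starting there is \<open>{q}\<close>.\<close>
  then have "Max (fst ` X) \<in> fst ` X" using fin by simp
  then obtain q where "q \<in> X" "fst q = Max (fst ` X)" by auto
  then have q: "q \<in> X" "\<And>p. p \<in> X \<Longrightarrow> fst p \<le> fst q" using fin by simp_all
  have "card C \<le> 1" if "C \<subseteq> X" "q \<in> C" "\<forall>p\<in>C. fst q \<le> fst p" for C
  proof -
    have "C \<subseteq> {q}"
      using that q inj by (metis antisym inj_onD insertCI subsetD subsetI)
    then show ?thesis using card_mono[of "{q}" C] by simp
  qed
  moreover have "card {p\<in>X. fst p \<le> fst q} \<le> j + 2"
    using card card_mono[OF fin, of "{p\<in>X. fst p \<le> fst q}"] by simp
  ultimately show ?case using X q(1) by (intro exI[of _ X] exI[of _ q]) auto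
next
  case (Suc i)
  then obtain A q where A: "es_set (Suc i) (Suc j) A" and q: "q \<in> A"
    and short: "\<And>C. C \<subseteq> A \<Longrightarrow> cup C \<Longrightarrow> q \<in> C \<Longrightarrow> \<forall>p\<in>C. fst q \<le> fst p \<Longrightarrow> card C \<le> Suc i"
    and left: "card {p\<in>A. fst p \<le> fst q} \<le> j + 2"
    by blast
  have fin: "finite A" using A unfolding es_set_def generic_def by blast
  obtain B where B: "es_set (Suc (Suc i)) j B" and s: "steep A B"
    using exists_steep_es_set[OF fin exists_es_set] by blast
  have gB: "generic B" and finB: "finite B" using B unfolding es_set_def generic_def by blast+
  have "card C \<le> Suc (Suc i)"
    if C: "C \<subseteq> A \<union> B" "cup C" "q \<in> C" "\<forall>p\<in>C. fst q \<le> fst p" for C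
  proof -
    have "card (C \<inter> B) \<le> 1" using cup_meets_upper[OF s gB C(2,3) q] .
    moreover have "card (C \<inter> A) \<le> Suc i"
      using short[of "C \<inter> A"] cup_subset[OF C(2), of "C \<inter> A"] C q by blast
    ultimately show ?thesis using card_split[OF fin finB C(1)] by linarith
  qed
  moreover have "{p \<in> A \<union> B. fst p \<le> fst q} = {p\<in>A. fst p \<le> fst q}"
    using steep_less[OF s q] by fastforce
  ultimately show ?case
    using es_set_steep_Un[OF s A B] q left by (intro exI[of _ "A \<union> B"] exI[of _ q]) auto
qed

text \<open>Mirror image of the previous lemma: now cups ending at \<open>q\<close> are short, so
  that a longer cup ending at \<open>q\<close> has to use points of a set placed below
  \<open>X\<close>.\<close>

lemma exists_es_set_short_cups_to_point:
  "\<exists>X q. es_set (Suc i) (Suc j) X \<and> q \<in> X \<and>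
     (\<forall>C\<subseteq>X. cup C \<longrightarrow> q \<in> C \<longrightarrow> (\<forall>p\<in>C. fst p \<le> fst q) \<longrightarrow> card C \<le> Suc i) \<and>
     card {p\<in>X. fst q \<le> fst p} \<le> j + 2"
proof -
  obtain X q where X: "es_set (Suc i) (Suc j) X" and q: "q \<in> X"
    and short: "\<And>C. C \<subseteq> X \<Longrightarrow> cup C \<Longrightarrow> q \<in> C \<Longrightarrow> \<forall>p\<in>C. fst q \<le> fst p \<Longrightarrow> card C \<le> Suc i"
    and left: "card {p\<in>X. fst p \<le> fst q} \<le> j + 2"
    using exists_es_set_short_cups_from_point by blast
  have "card C \<le> Suc i"
    if C: "C \<subseteq> mirror ` X" "cup C" "mirror q \<in> C" "\<forall>p\<in>C. fst p \<le> fst (mirror q)" for C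
  proof -
    obtain D where D: "D \<subseteq> X" "C = mirror ` D" using C(1) by (meson subset_image_iff)
    have "q \<in> D" using C(3) D by (metis imageE mirror_mirror)
    then show ?thesis
      using short[OF D(1)] C D by (simp add: cup_mirror card_image inj_mirror)
  qed
  moreover have "{p \<in> mirror ` X. fst (mirror q) \<le> fst p} = mirror ` {p\<in>X. fst p \<le> fst q}"
    by auto
  then have "card {p \<in> mirror ` X. fst (mirror q) \<le> fst p} \<le> j + 2"
    using left by (simp add: card_image inj_mirror)
  ultimately show ?thesis
    using es_set_mirror[OF X] q by blast
qed

section \<open>Doubling a point\<close>

text \<open>The middle clauses say that the direction from \<open>q\<close> to \<open>q'\<close> is
  steeper than all those from \<open>q\<close> to \<open>A\<close>. The last clause says that
  \<open>q'\<close> can replace \<open>q\<close> in orientations; it demands nothing when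
  \<open>orient z w q = 0\<close>, for instance when \<open>z = q\<close>.\<close>

definition steep_twin :: "(real \<times> real) set \<Rightarrow> real \<times> real \<Rightarrow> real \<times> real \<Rightarrow> bool" where
  "steep_twin A q q' \<longleftrightarrow> fst q < fst q' \<and> (\<forall>z\<in>A. fst q < fst z \<longrightarrow> fst q' < fst z) \<and>
    (\<forall>z\<in>A. fst z < fst q \<longrightarrow> 0 < orient z q q') \<and>
    (\<forall>z\<in>A. fst q < fst z \<longrightarrow> orient q q' z < 0) \<and>
    (\<forall>z\<in>A. \<forall>w\<in>A. (0 < orient z w q \<longrightarrow> 0 < orient z w q') \<and>
      (orient z w q < 0 \<longrightarrow> orient z w q' < 0))"

lemma exists_steep_twin:
  assumes fin: "finite A"
  shows "\<exists>q'. steep_twin A q q'"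
proof -
  \<comment> \<open>On the parabola \<open>t \<mapsto> q + (t\<^sup>2, t)\<close> the slope from \<open>q\<close> tends to infinity as \<open>t\<close> tends to 0.\<close>
  let ?t = "\<lambda>t::real. q + (t\<^sup>2, t)"
  have pos: "\<forall>\<^sub>F t in at_right 0. 0 < (t::real)"
    by (simp add: eventually_at_right_less)
  have small: "\<forall>\<^sub>F t in at_right 0. c * t < d" if "0 < d" for c d :: real
  proof -
    have "((\<lambda>t. c * t) \<longlongrightarrow> c * 0) (at_right 0)" by (intro tendsto_intros)
    then show ?thesis using that by (auto dest: order_tendstoD(2))
  qed
  have "\<forall>\<^sub>F t in at_right 0. fst q < fst z \<longrightarrow> fst (?t t) < fst z" for z
  proof -
    have "((\<lambda>t. fst (?t t)) \<longlongrightarrow> fst q + 0\<^sup>2) (at_right 0)"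
      unfolding fst_add fst_conv by (intro tendsto_intros)
    then show ?thesis
      by (cases "fst q < fst z") (auto dest: order_tendstoD(2))
  qed
  then have 1: "\<forall>\<^sub>F t in at_right 0. \<forall>z\<in>A. fst q < fst z \<longrightarrow> fst (?t t) < fst z"
    using fin by (intro eventually_ball_finite) auto
  have "\<forall>\<^sub>F t in at_right 0. fst z < fst q \<longrightarrow> 0 < orient z q (?t t)" for z
  proof (cases "fst z < fst q")
    case True
    then have "\<forall>\<^sub>F t in at_right 0. (snd q - snd z) * t < fst q - fst z" by (intro small) simp
    with pos show ?thesis
    proof eventually_elim
      case (elim t)
      \<comment> \<open>The bracket is positive for small \<open>t\<close>, because the linear term
        vanishes in the limit and a positive width remains.\<close>
      have "orient z q (?t t) = t * ((fst q - fst z) - (snd q - snd z) * t)"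
        by (simp add: orient_def algebra_simps power2_eq_square)
      then show ?case using elim by simp
    qed
  qed simp
  then have 2: "\<forall>\<^sub>F t in at_right 0. \<forall>z\<in>A. fst z < fst q \<longrightarrow> 0 < orient z q (?t t)"
    using fin by (intro eventually_ball_finite) auto
  have "\<forall>\<^sub>F t in at_right 0. fst q < fst z \<longrightarrow> orient q (?t t) z < 0" for z
  proof (cases "fst q < fst z")
    case True
    then have "\<forall>\<^sub>F t in at_right 0. (snd z - snd q) * t < fst z - fst q" by (intro small) simp
    with pos show ?thesis
    proof eventually_elim
      case (elim t)
      have "orient q (?t t) z = - (t * ((fst z - fst q) - (snd z - snd q) * t))"
        by (simp add: orient_def algebra_simps power2_eq_square)
      then show ?case using elim by simp
    qed
  qed simp
  then have 3: "\<forall>\<^sub>F t in at_right 0. \<forall>z\<in>A. fst q < fst z \<longrightarrow> orient q (?t t) z < 0"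
    using fin by (intro eventually_ball_finite) auto
  have "\<forall>\<^sub>F t in at_right 0. (0 < orient z w q \<longrightarrow> 0 < orient z w (?t t)) \<and>
      (orient z w q < 0 \<longrightarrow> orient z w (?t t) < 0)" for z w
  proof -
    have "((\<lambda>t. orient z w (?t t)) \<longlongrightarrow> (fst w - fst z) * (snd q + 0 - snd z) -
        (snd w - snd z) * (fst q + 0\<^sup>2 - fst z)) (at_right 0)"
      unfolding orient_def fst_add snd_add fst_conv snd_conv by (intro tendsto_intros)
    then have lim: "((\<lambda>t. orient z w (?t t)) \<longlongrightarrow> orient z w q) (at_right 0)"
      by (simp add: orient_def)
    show ?thesis
      \<comment> \<open>A nonzero limit fixes the sign near 0; for the limit 0 both implications are
        vacuous.\<close>
      using order_tendstoD[OF lim, of 0]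
      by (cases "orient z w q" "0::real" rule: linorder_cases) auto
  qed
  then have 4: "\<forall>\<^sub>F t in at_right 0. \<forall>z\<in>A. \<forall>w\<in>A. (0 < orient z w q \<longrightarrow> 0 < orient z w (?t t)) \<and>
      (orient z w q < 0 \<longrightarrow> orient z w (?t t) < 0)"
    using fin by (intro eventually_ball_finite ballI) auto
  have "\<forall>\<^sub>F t in at_right 0. steep_twin A q (?t t)"
    using pos 1 2 3 4 by eventually_elim (simp add: steep_twin_def del: split_paired_All)
  then show ?thesis
    using eventually_happens trivial_limit_at_right_real by blast
qed

section \<open>Exchanging a point with its twin\<close>

context
  fixes A :: "(real \<times> real) set" and q q' :: "real \<times> real"
  assumes A: "generic A" and q: "q \<in> A" and twin: "steep_twin A q q'"
begin

lemma twin_less: "fst q < fst q'"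
  using twin unfolding steep_twin_def by blast

lemma twin_right: "z \<in> A \<Longrightarrow> fst q < fst z \<Longrightarrow> fst q' < fst z"
  using twin unfolding steep_twin_def by blast

lemma twin_cup: "z \<in> A \<Longrightarrow> fst z < fst q \<Longrightarrow> 0 < orient z q q'"
  using twin unfolding steep_twin_def by blast

lemma twin_cap: "z \<in> A \<Longrightarrow> fst q < fst z \<Longrightarrow> orient q q' z < 0"
  using twin unfolding steep_twin_def by blast

lemma twin_notin: "q' \<notin> A"
  using twin_right twin_less by blast

lemma twin_sgn:
  assumes "z \<in> A" "w \<in> A" "z \<noteq> w" "z \<noteq> q" "w \<noteq> q"
  shows "sgn (orient z w q') = sgn (orient z w q)"
  using generic_orient_neq_0[OF A assms(1,2) q assms(3-5)] twin assms(1,2)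
  unfolding steep_twin_def by (cases "orient z w q" "0::real" rule: linorder_cases) auto

text \<open>At most one of the three points is \<open>q\<close>; rotating it into the last place of
  \<open>orient\<close> makes \<open>twin_sgn\<close> applicable.\<close>

lemma twin_swap:
  assumes pqr: "p \<in> A" "r \<in> A" "s \<in> A" "fst p < fst r" "fst r < fst s"
  defines "\<psi> \<equiv> id(q := q')"
  shows "fst (\<psi> p) < fst (\<psi> r)" "fst (\<psi> r) < fst (\<psi> s)"
    "sgn (orient (\<psi> p) (\<psi> r) (\<psi> s)) = sgn (orient p r s)"
proof -
  show "fst (\<psi> p) < fst (\<psi> r)" "fst (\<psi> r) < fst (\<psi> s)"
    using pqr twin_less twin_right[OF pqr(2)] twin_right[OF pqr(3)] unfolding \<psi>_def by auto
  consider "p = q" "r \<noteq> q" "s \<noteq> q" | "p \<noteq> q" "r = q" "s \<noteq> q" | "p \<noteq> q" "r \<noteq> q" "s = q"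
    | "p \<noteq> q" "r \<noteq> q" "s \<noteq> q"
    using pqr by fastforce
  then show "sgn (orient (\<psi> p) (\<psi> r) (\<psi> s)) = sgn (orient p r s)"
  proof cases
    case 1
    then show ?thesis
      using twin_sgn[of r s] pqr orient_rotate[of q r s] orient_rotate[of q' r s]
      unfolding \<psi>_def by auto
  next
    case 2
    moreover have "s \<noteq> p" using pqr by auto
    ultimately show ?thesis
      using twin_sgn[of s p] pqr orient_rotate[of s p q] orient_rotate[of s p q']
      unfolding \<psi>_def by auto
  next
    case 3
    then show ?thesis
      using twin_sgn[of p r] pqr unfolding \<psi>_def by auto
  qed (simp add: \<psi>_def)
qed

text \<open>Triples with \<open>q'\<close> but without \<open>q\<close> inherit a nonzero
  orientation from \<open>q\<close>; triples with both are decided by the steepness of the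
  pair.\<close>

lemma twin_generic: "generic (insert q' A)"
proof -
  have "orient p r s \<noteq> 0"
    if prs: "p \<in> insert q' A" "r \<in> insert q' A" "s \<in> insert q' A" "fst p < fst r" "fst r < fst s" for p r s
  proof -
    have inA: "x \<in> A" if "x \<noteq> q'" "x \<in> insert q' A" for x
      using that by blast
    have right: "fst q < fst x" if "fst q' < fst x" for x
      using that twin_less by linarith
    \<comment> \<open>No point of \<open>A\<close> has its abscissa strictly between those of
      \<open>q\<close> and \<open>q'\<close>.\<close>
    have left: "fst x < fst q" if "fst x < fst q'" "x \<in> A" "x \<noteq> q" for x
      using that twin_right[of x] A q unfolding generic_def
      by (metis inj_onD less_asym linorder_neqE_linordered_idom)
    have *: "orient z w q' \<noteq> 0" if "z \<in> A" "w \<in> A" "z \<noteq> w" "z \<noteq> q" "w \<noteq> q" for z w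
      using twin_sgn[OF that] generic_orient_neq_0[OF A that(1,2) q that(3-5)] by (metis sgn_0_0)
    consider "p \<in> A" "r \<in> A" "s \<in> A" | "p = q'" "r \<in> A" "s \<in> A" | "p \<in> A" "r = q'" "s \<in> A"
      | "p \<in> A" "r \<in> A" "s = q'"
      using prs less_trans[OF prs(4,5)] by (metis insertE less_irrefl)
    then show ?thesis
    proof cases
      case 1
      then show ?thesis using A prs unfolding generic_def by blast
    next
      case 2
      then have "fst q < fst r" "fst q < fst s" using prs right by (auto intro: less_trans)
      then have "r \<noteq> s" "r \<noteq> q" "s \<noteq> q" using prs(5) by auto
      then show ?thesis
        using *[of r s] 2 orient_rotate[of q' r s] by simp
    next
      case 3
      show ?thesis
      proof (cases "p = q")
        case True
        then show ?thesis using twin_cap[of s] 3 prs right by force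
      next
        case False
        then show ?thesis
          using *[of s p] 3 prs orient_rotate[of s p q'] right[of s] by force
      qed
    next
      case 4
      then have "fst p < fst q" using left prs twin_less
        by (metis less_trans order_less_irrefl)
      then show ?thesis
        using *[of p r] twin_cup[of p] 4 prs by (cases "r = q") auto
    qed
  qed
  moreover have "fst q' \<notin> fst ` A"
    using twin_right twin_less by force
  ultimately show ?thesis
    using A unfolding generic_def by auto
qed

text \<open>Putting \<open>q\<close> in place of \<open>q'\<close> keeps size and shape. Hence
  doubling can only enlarge those cups and caps that contain both points.\<close>

lemma twin_unswap:
  assumes D: "D \<subseteq> insert q' A" and both: "\<not> (q \<in> D \<and> q' \<in> D)"
  shows "\<exists>E\<subseteq>A. card E = card D \<and> (cup D \<longrightarrow> cup E) \<and> (cap D \<longrightarrow> cap E)"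
proof (cases "q' \<in> D")
  case False
  then show ?thesis using D by blast
next
  case True
  define \<psi> where "\<psi> = id(q := q')"
  define E where "E = insert q (D - {q'})"
  have E: "E \<subseteq> A" using D q unfolding E_def by blast
  have D_eq: "D = \<psi> ` E" using True both unfolding E_def \<psi>_def by (auto simp: image_iff)
  have "inj_on \<psi> E"
    using E twin_notin unfolding \<psi>_def by (auto simp: inj_on_def)
  then have "card E = card D" unfolding D_eq by (simp add: card_image)
  moreover have "cup E" if "cup D"
    unfolding cup_def
  proof (intro ballI impI)
    fix p r s assume prs: "p \<in> E" "r \<in> E" "s \<in> E" "fst p < fst r" "fst r < fst s"
    then have "0 < orient (\<psi> p) (\<psi> r) (\<psi> s)"
      using that twin_swap[of p r s] E unfolding D_eq cup_def \<psi>_def by blast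
    then show "0 < orient p r s"
      using twin_swap(3)[of p r s] prs E unfolding \<psi>_def by (metis sgn_1_pos sgn_pos subsetD)
  qed
  moreover have "cap E" if "cap D"
    unfolding cap_def
  proof (intro ballI impI)
    fix p r s assume prs: "p \<in> E" "r \<in> E" "s \<in> E" "fst p < fst r" "fst r < fst s"
    then have "orient (\<psi> p) (\<psi> r) (\<psi> s) < 0"
      using that twin_swap[of p r s] E unfolding D_eq cap_def \<psi>_def by blast
    then show "orient p r s < 0"
      using twin_swap(3)[of p r s] prs E unfolding \<psi>_def by (metis sgn_1_neg sgn_neg subsetD)
  qed
  ultimately show ?thesis using E by blast
qed

lemma twin_cups_le:
  assumes "cups_le n A" "D \<subseteq> insert q' A" "cup D" "\<not> (q \<in> D \<and> q' \<in> D)"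
  shows "card D \<le> n"
  using twin_unswap[OF assms(2,4)] assms(1,3) unfolding cups_le_def by metis

lemma twin_caps_le:
  assumes "caps_le n A" "D \<subseteq> insert q' A" "cap D" "\<not> (q \<in> D \<and> q' \<in> D)"
  shows "card D \<le> n"
  using twin_unswap[OF assms(2,4)] assms(1,3) unfolding caps_le_def by metis

end

section \<open>The construction\<close>

lemma steep_translate: "steep ((+) c ` A) ((+) c ` B) \<longleftrightarrow> steep A B"
  unfolding steep_def by (simp add: orient_translate)

text \<open>Moving both sets back by the translation that was applied to \<open>B\<close> leaves
  \<open>B\<close> fixed, so a lower set can be added after the upper one has been chosen.\<close>

lemma exists_steep_es_set_below:
  assumes "finite B"
  shows "\<exists>A. es_set i j A \<and> steep A B"
proof -
  obtain A where A: "es_set i j A" using exists_es_set by blast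
  then have "finite A" unfolding es_set_def generic_def by blast
  then obtain c where "steep A ((+) c ` B)"
    using exists_steep_translate assms by blast
  then have "steep ((+) (- c) ` A) ((+) (- c) ` (+) c ` B)"
    by (simp only: steep_translate)
  then have "steep ((+) (- c) ` A) B"
    by (simp add: image_image)
  then show ?thesis using es_set_translate[OF A] by blast
qed

text \<open>The three orientations are the barycentric coordinates of \<open>w\<close> scaled by
  their sum \<open>orient p q r\<close>. Positivity makes \<open>w\<close> strictly interior and
  forces \<open>p\<close>, \<open>q\<close>, \<open>r\<close> to be counterclockwise.\<close>

definition in_triangle :: "real \<times> real \<Rightarrow> real \<times> real \<Rightarrow> real \<times> real \<Rightarrow> real \<times> real \<Rightarrow> bool" where
  "in_triangle w p q r \<longleftrightarrow> 0 < orient p q w \<and> 0 < orient q r w \<and> 0 < orient r p w"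

text \<open>Here \<open>i = l - 4\<close> and \<open>j = m - 4\<close>.\<close>

lemma exists_doubled_es_set:
  "\<exists>X. generic X \<and> card X = Suc ((i + j + 4) choose (i + 2)) \<and> caps_le (j + 3) X \<and>
     (\<forall>C\<subseteq>X. cup C \<longrightarrow> card C = i + 4 \<longrightarrow>
       (\<exists>W\<subseteq>X. ((i + j + 2) choose (i + 1)) \<le> card W + (j + 2) \<and>
         (\<forall>w\<in>W. \<exists>p\<in>C. \<exists>q\<in>C. \<exists>r\<in>C. in_triangle w p q r)))"
proof -
  obtain Q q where Q: "es_set (Suc i) (Suc j) Q" and q: "q \<in> Q"
    and short: "\<And>C. C \<subseteq> Q \<Longrightarrow> cup C \<Longrightarrow> q \<in> C \<Longrightarrow> \<forall>p\<in>C. fst p \<le> fst q \<Longrightarrow> card C \<le> Suc i"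
    and right: "card {p\<in>Q. fst q \<le> fst p} \<le> j + 2"
    using exists_es_set_short_cups_to_point by blast
  have gQ: "generic Q" and finQ: "finite Q" and cQ: "cups_le (i + 2) Q" "caps_le (j + 2) Q"
    and cardQ: "card Q = ((i + j + 2) choose (i + 1))"
    using Q unfolding es_set_def generic_def by auto
  obtain P where P: "es_set i (j + 2) P" and PQ: "steep P Q"
    using exists_steep_es_set_below[OF finQ] by blast
  have gP: "generic P" and finP: "finite P" and cP: "cups_le (i + 1) P" "caps_le (j + 3) P"
    and cardP: "card P = ((i + j + 2) choose i)"
    using P unfolding es_set_def generic_def by (auto simp: eval_nat_numeral)
  define A0 where "A0 = P \<union> Q"
  have gA0: "generic A0" unfolding A0_def by (rule generic_steep_Un[OF gP gQ PQ])
  have finA0: "finite A0" using finP finQ unfolding A0_def by blast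
  have cA0: "cups_le (i + 2) A0" "caps_le (j + 3) A0"
    using cups_le_steep_Un[OF PQ gP gQ, of "i + 1"] caps_le_steep_Un[OF PQ gP gQ, of "j + 2"] cP cQ
    unfolding A0_def by (simp_all add: eval_nat_numeral)
  have qA0: "q \<in> A0" using q unfolding A0_def by blast
  obtain q' where twin: "steep_twin A0 q q'" using exists_steep_twin[OF finA0] by blast
  note tw = gA0 qA0 twin
  define A where "A = insert q' A0"
  have gA: "generic A" unfolding A_def by (rule twin_generic[OF tw])
  have finA: "finite A" using finA0 unfolding A_def by blast
  have capsA: "caps_le (j + 3) A"
    unfolding caps_le_def
  proof (intro allI impI)
    fix D assume D: "D \<subseteq> A" "cap D"
    show "card D \<le> j + 3"
    proof (cases "q \<in> D \<and> q' \<in> D")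
      case False
      then show ?thesis using twin_caps_le[OF tw cA0(2)] D unfolding A_def by blast
    next
      case True
      \<comment> \<open>A point left of \<open>q\<close> would turn left through \<open>q\<close>
        and \<open>q'\<close>. This excludes all of \<open>P\<close>, and caps inside
        \<open>Q\<close> are shorter by one.\<close>
      have "D - {q'} \<subseteq> Q"
      proof
        fix z assume z: "z \<in> D - {q'}"
        then have zA0: "z \<in> A0" using D unfolding A_def by blast
        have "\<not> fst z < fst q"
          using twin_cup[OF tw zA0] twin_less[OF tw] D(2) z True unfolding cap_def by fastforce
        then show "z \<in> Q"
          using zA0 steep_less[OF PQ _ q] unfolding A0_def by blast
      qed
      then have "card (D - {q'}) \<le> j + 2"
        using cQ(2) cap_subset[OF D(2), of "D - {q'}"] unfolding caps_le_def by blast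
      then show ?thesis
        using True finite_subset[OF D(1) finA] by (simp add: card_Diff_singleton)
    qed
  qed
  \<comment> \<open>\<open>B\<close> is chosen after \<open>q'\<close>, so it also lies above the
    steep line through \<open>q\<close> and \<open>q'\<close>.\<close>
  obtain B where B: "es_set (i + 2) (j + 1) B" and AB: "steep A B"
    using exists_steep_es_set[OF finA exists_es_set] by blast
  have gB: "generic B" and finB: "finite B" and cB: "cups_le (i + 3) B" "caps_le (j + 2) B"
    and cardB: "card B = ((i + j + 3) choose (i + 2))"
    using B unfolding es_set_def generic_def by (auto simp: eval_nat_numeral)
  define X where "X = A \<union> B"
  have "generic X" unfolding X_def by (rule generic_steep_Un[OF gA gB AB])
  moreover have "card X = Suc ((i + j + 4) choose (i + 2))"
  proof -
    have "card X = card A + card B"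
      unfolding X_def using finA finB steep_disjoint[OF AB] by (rule card_Un_disjoint)
    moreover have "card A = Suc (card A0)"
      unfolding A_def using finA0 twin_notin[OF tw] by simp
    moreover have "card A0 = card P + card Q"
      unfolding A0_def using finP finQ steep_disjoint[OF PQ] by (rule card_Un_disjoint)
    \<comment> \<open>Pascal's rule twice: \<open>P\<close> with \<open>Q\<close>, then their union
      with \<open>B\<close>; the extra point is \<open>q'\<close>.\<close>
    ultimately show ?thesis
      using cardP cardQ cardB by (simp add: eval_nat_numeral)
  qed
  moreover have "caps_le (j + 3) X"
    unfolding X_def
    using caps_le_steep_Un[OF AB gA gB, of "j + 2"] capsA cB(2) by (simp add: eval_nat_numeral)
  moreover have "\<exists>W\<subseteq>X. ((i + j + 2) choose (i + 1)) \<le> card W + (j + 2) \<and>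
      (\<forall>w\<in>W. \<exists>p\<in>C. \<exists>q\<in>C. \<exists>r\<in>C. in_triangle w p q r)"
    if C: "C \<subseteq> X" "cup C" "card C = i + 4" for C
  proof -
    have "\<not> C \<subseteq> B"
    proof
      assume "C \<subseteq> B"
      then have "card C \<le> i + 3" using cB(1) C(2) unfolding cups_le_def by blast
      then show False using C(3) by simp
    qed
    then obtain a where "a \<in> C" "a \<in> A" using C(1) unfolding X_def by blast
    then have B1: "card (C \<inter> B) \<le> 1" using cup_meets_upper[OF AB gB C(2)] by blast
    define D where "D = C \<inter> A"
    have D: "D \<subseteq> A" "cup D" "finite D"
      using cup_subset[OF C(2), of D] finA unfolding D_def by auto
    have split: "card C \<le> card D + card (C \<inter> B)"
      using card_split[OF finA finB] C(1) unfolding D_def X_def by blast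
    have both: "q \<in> D" "q' \<in> D"
    proof -
      \<comment> \<open>At least \<open>i + 3\<close> points remain outside \<open>B\<close>, more
        than a cup without the full pair can have.\<close>
      have "\<not> card D \<le> i + 2" using split B1 C(3) by linarith
      then show "q \<in> D" "q' \<in> D"
        using twin_cups_le[OF tw cA0(1), of D] D unfolding A_def by blast+
    qed
    define E where "E = D - {q'}"
    have E: "E \<subseteq> A0" "cup E" "q \<in> E" "card D = Suc (card E)"
      using D cup_subset[OF D(2), of E] both twin_less[OF tw] card_Suc_Diff1[OF D(3) both(2)]
      unfolding E_def A_def by auto
    \<comment> \<open>A point further right would lie beyond \<open>q'\<close> and form a cap with
      \<open>q\<close> and \<open>q'\<close>.\<close>
    have E_left: "fst z \<le> fst q" if "z \<in> E" for z
      using twin_cap[OF tw, of z] twin_right[OF tw, of z] twin_less[OF tw] D(2) both that E(1)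
      unfolding E_def cup_def by fastforce
    have "card E \<le> i + 2" using cA0(1) E unfolding cups_le_def by blast
    \<comment> \<open>The part in \<open>A\<close> has at most \<open>i + 3\<close> points, so the
      cup needs a point \<open>b\<close> of \<open>B\<close>.\<close>
    then have "card (C \<inter> B) \<noteq> 0" using split E(4) C(3) by linarith
    then have "C \<inter> B \<noteq> {}" by (metis card.empty)
    then obtain b where b: "b \<in> C" "b \<in> B" by blast
    \<comment> \<open>\<open>E\<close> has at least \<open>i + 2\<close> points and ends in
      \<open>q\<close>, one too many for a cup inside \<open>Q\<close>; hence it contains a point
      \<open>p\<close> of \<open>P\<close>.\<close>
    have "\<not> card E \<le> Suc i" using split B1 E(4) C(3) by linarith
    then have "\<not> E \<subseteq> Q" using short[OF _ E(2,3)] E_left by blast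
    then obtain p where p: "p \<in> C" "p \<in> P"
      using E(1) unfolding A0_def E_def D_def by blast
    define W where "W = {w\<in>Q. fst w < fst q}"
    have "Q = W \<union> {p\<in>Q. fst q \<le> fst p}" unfolding W_def by auto
    then have "card Q \<le> card W + card {p\<in>Q. fst q \<le> fst p}"
      by (metis card_Un_le)
    then have "((i + j + 2) choose (i + 1)) \<le> card W + (j + 2)"
      using cardQ right by linarith
    \<comment> \<open>\<open>w\<close> is above the side \<open>p q\<close> because \<open>Q\<close>
      is steep above \<open>P\<close>, and on the inner side of the other two because
      \<open>b\<close> is steep above \<open>A\<close>.\<close>
    moreover have "in_triangle w p q b" if "w \<in> W" for w
    proof -
      have w: "w \<in> Q" "fst w < fst q" using that unfolding W_def by auto
      have inA: "w \<in> A" "p \<in> A" "q \<in> A" using w p q unfolding A_def A0_def by auto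
      have "0 < orient p q w"
        using steep_cap[OF PQ p(2) w(1) q w(2)] orient_swap[of p w q] by linarith
      moreover have "0 < orient q b w"
        using steep_cup[OF AB inA(1,3) b(2) w(2)] orient_rotate[of w q b] by simp
      moreover have "0 < orient b p w"
        using steep_cup[OF AB inA(2,1) b(2) steep_less[OF PQ p(2) w(1)]] orient_rotate[of b p w] by simp
      ultimately show ?thesis unfolding in_triangle_def by blast
    qed
    moreover have "W \<subseteq> X" unfolding W_def X_def A_def A0_def by blast
    moreover have "q \<in> C" using both(1) unfolding D_def by blast
    ultimately show ?thesis using p(1) b(1) by blast
  qed
  ultimately show ?thesis by blast
qed

section \<open>From triangles to points inside\<close>

lemma in_triangle_imp_interior:
  assumes "in_triangle w p q r"
  shows "w \<in> interior (convex hull {p, q, r})"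
proof -
  let ?S = "{z. in_triangle z p q r}"
  have "?S \<subseteq> convex hull {p, q, r}"
  proof
    fix z assume z: "z \<in> ?S"
    define T where "T = orient p q r"
    have T: "orient q r z + orient r p z + orient p q z = T"
      unfolding T_def orient_def by (simp add: algebra_simps)
    have pos: "0 < orient q r z" "0 < orient r p z" "0 < orient p q z" and "0 < T"
      using z T unfolding in_triangle_def by auto
    \<comment> \<open>Barycentric coordinates in a form without denominators.\<close>
    have "T *\<^sub>R z = orient q r z *\<^sub>R p + orient r p z *\<^sub>R q + orient p q z *\<^sub>R r"
      unfolding T_def orient_def by (rule prod_eqI) (simp_all add: algebra_simps)
    then have "z = (1 / T) *\<^sub>R (orient q r z *\<^sub>R p + orient r p z *\<^sub>R q + orient p q z *\<^sub>R r)"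
      using \<open>0 < T\<close> by (metis divide_self_if less_irrefl scaleR_one scaleR_scaleR times_divide_eq_left mult_1)
    then have "z = (orient q r z / T) *\<^sub>R p + (orient r p z / T) *\<^sub>R q + (orient p q z / T) *\<^sub>R r"
      by (simp add: scaleR_add_right)
    moreover have "orient q r z / T + orient r p z / T + orient p q z / T = 1"
      using T \<open>0 < T\<close> by (simp add: field_simps)
    moreover have "0 \<le> orient q r z / T" "0 \<le> orient r p z / T" "0 \<le> orient p q z / T"
      using pos \<open>0 < T\<close> by simp_all
    ultimately show "z \<in> convex hull {p, q, r}"
      unfolding convex_hull_3 by blast
  qed
  \<comment> \<open>An open subset of the hull lies in its interior.\<close>
  moreover have "open ?S"
    unfolding in_triangle_def orient_def
    by (intro open_Collect_conj open_Collect_less continuous_intros)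
  ultimately show ?thesis
    using interior_maximal assms by blast
qed

lemma points_inside_ge:
  assumes "finite X" "W \<subseteq> X" "\<And>w. w \<in> W \<Longrightarrow> \<exists>p\<in>C. \<exists>q\<in>C. \<exists>r\<in>C. in_triangle w p q r"
  shows "card W \<le> points_inside X C"
  unfolding points_inside_def
proof (rule card_mono)
  show "W \<subseteq> {p \<in> X. p \<in> interior (convex hull C)}"
  proof
    fix w assume w: "w \<in> W"
    then obtain p q r where pqr: "p \<in> C" "q \<in> C" "r \<in> C" "in_triangle w p q r"
      using assms(3) by blast
    then have "interior (convex hull {p, q, r}) \<subseteq> interior (convex hull C)"
      by (intro interior_mono hull_mono) simp
    then show "w \<in> {p \<in> X. p \<in> interior (convex hull C)}"
      using in_triangle_imp_interior[OF pqr(4)] w assms(2) by blast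
  qed
qed (use assms(1) in simp)

text \<open>The reflection reverses orientation, so two vertices are exchanged to keep the triangle
  counterclockwise.\<close>

lemma in_triangle_flip:
  assumes "in_triangle w p q r"
  shows "in_triangle (flip w) (flip q) (flip p) (flip r)"
  using assms orient_swap orient_rotate unfolding in_triangle_def orient_flip
  by (metis minus_minus)

lemma exists_large_set_deep_cups:
  fixes l m :: nat
  assumes "l \<ge> 4" "m \<ge> 4"
  shows "\<exists>X. generic X \<and> card X = fES l m \<and> caps_le (m - 1) X \<and>
     (\<forall>C\<subseteq>X. cup C \<longrightarrow> card C = l \<longrightarrow>
       (\<exists>W\<subseteq>X. int ((l + m - 6) choose (l - 3)) - int m + 1 < int (card W) \<and>
         (\<forall>w\<in>W. \<exists>p\<in>C. \<exists>q\<in>C. \<exists>r\<in>C. in_triangle w p q r)))"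
proof -
  obtain i where l: "l = i + 4" using assms(1) by (metis add.commute le_Suc_ex)
  obtain j where m: "m = j + 4" using assms(2) by (metis add.commute le_Suc_ex)
  obtain X where X: "generic X" "card X = Suc ((i + j + 4) choose (i + 2))" "caps_le (j + 3) X"
    and deep: "\<And>C. C \<subseteq> X \<Longrightarrow> cup C \<Longrightarrow> card C = i + 4 \<Longrightarrow>
       \<exists>W\<subseteq>X. ((i + j + 2) choose (i + 1)) \<le> card W + (j + 2) \<and>
         (\<forall>w\<in>W. \<exists>p\<in>C. \<exists>q\<in>C. \<exists>r\<in>C. in_triangle w p q r)"
    using exists_doubled_es_set[of i j] by blast
  have nat: "l + m - 4 = i + j + 4" "l - 2 = i + 2" "m - 1 = j + 3" "l + m - 6 = i + j + 2" "l - 3 = i + 1"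
    unfolding l m by simp_all
  have "\<exists>W\<subseteq>X. int ((l + m - 6) choose (l - 3)) - int m + 1 < int (card W) \<and>
         (\<forall>w\<in>W. \<exists>p\<in>C. \<exists>q\<in>C. \<exists>r\<in>C. in_triangle w p q r)"
    if C: "C \<subseteq> X" "cup C" "card C = l" for C
  proof -
    obtain W where W: "W \<subseteq> X" "((i + j + 2) choose (i + 1)) \<le> card W + (j + 2)"
      "\<forall>w\<in>W. \<exists>p\<in>C. \<exists>q\<in>C. \<exists>r\<in>C. in_triangle w p q r"
      using deep[OF C(1,2)] C(3) unfolding l by blast
    \<comment> \<open>As \<open>j + 2 = m - 2\<close>, the set \<open>W\<close> has at least one
      point more than the stated bound.\<close>
    have "int ((l + m - 6) choose (l - 3)) - int m + 1 < int (card W)"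
      using W(2) m unfolding nat by linarith
    then show ?thesis using W by blast
  qed
  then show ?thesis
    using X unfolding fES_def nat by auto
qed

section \<open>The two inequalities\<close>

lemma exists_avoiding_deep_cups:
  fixes l m a :: nat
  assumes "l \<ge> 4" "m \<ge> 4"
  shows "\<exists>X. admissible X \<and> card X \<ge> fES l m \<and>
     avoids X l m (int ((l + m - 6) choose (l - 3)) - int m + 1) (int a)"
proof -
  obtain X where X: "generic X" "card X = fES l m" "caps_le (m - 1) X"
    and deep: "\<And>C. C \<subseteq> X \<Longrightarrow> cup C \<Longrightarrow> card C = l \<Longrightarrow>
       \<exists>W\<subseteq>X. int ((l + m - 6) choose (l - 3)) - int m + 1 < int (card W) \<and>
         (\<forall>w\<in>W. \<exists>p\<in>C. \<exists>q\<in>C. \<exists>r\<in>C. in_triangle w p q r)"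
    using exists_large_set_deep_cups[OF assms] by blast
  have fin: "finite X" using X unfolding generic_def by blast
  have "int ((l + m - 6) choose (l - 3)) - int m + 1 < int (points_inside X C)"
    if C: "C \<subseteq> X" "is_cup l C" for C
  proof -
    obtain W where W: "W \<subseteq> X" "int ((l + m - 6) choose (l - 3)) - int m + 1 < int (card W)"
      "\<forall>w\<in>W. \<exists>p\<in>C. \<exists>q\<in>C. \<exists>r\<in>C. in_triangle w p q r"
      using deep[OF C(1) is_cup_imp_cup[OF C(2)]] by blast
    then have "card W \<le> points_inside X C"
      by (intro points_inside_ge[OF fin]) blast+
    then show ?thesis using W(2) by linarith
  qed
  \<comment> \<open>There is no \<open>m\<close>-cap at all, so the condition on caps holds for
    every \<open>a\<close>.\<close>
  moreover have "\<not> is_cap m C" if "C \<subseteq> X" for C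
  proof
    assume C: "is_cap m C"
    then have "card C \<le> m - 1"
      using X(3) that is_cap_imp_cap(1) unfolding caps_le_def by blast
    then show False using is_cap_imp_cap(2)[OF C] assms by linarith
  qed
  ultimately have "avoids X l m (int ((l + m - 6) choose (l - 3)) - int m + 1) (int a)"
    unfolding avoids_def by (meson not_less)
  then show ?thesis
    using X generic_imp_admissible by (metis order_refl)
qed

text \<open>Exchange \<open>l\<close> and \<open>m\<close> in the construction and reflect in the
  x-axis, which turns deep cups into deep caps.\<close>

lemma exists_avoiding_deep_caps:
  fixes l m a :: nat
  assumes "l \<ge> 4" "m \<ge> 4"
  shows "\<exists>X. admissible X \<and> card X \<ge> fES l m \<and>
     avoids X l m (int a) (int ((l + m - 6) choose (m - 3)) - int l + 1)"
proof -
  have comm: "m + l - 6 = l + m - 6" by simp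
  obtain Y where Y: "generic Y" "card Y = fES m l" "caps_le (l - 1) Y"
    and deep: "\<And>C. C \<subseteq> Y \<Longrightarrow> cup C \<Longrightarrow> card C = m \<Longrightarrow>
       \<exists>W\<subseteq>Y. int ((l + m - 6) choose (m - 3)) - int l + 1 < int (card W) \<and>
         (\<forall>w\<in>W. \<exists>p\<in>C. \<exists>q\<in>C. \<exists>r\<in>C. in_triangle w p q r)"
    using exists_large_set_deep_cups[OF assms(2,1)] unfolding comm by blast
  define X where "X = flip ` Y"
  have gX: "generic X" unfolding X_def by (rule generic_flip[OF Y(1)])
  then have fin: "finite X" unfolding generic_def by blast
  \<comment> \<open>Symmetry of the binomial coefficient: \<open>l - 2\<close> and
    \<open>m - 2\<close> add up to \<open>l + m - 4\<close>.\<close>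
  have "fES m l = fES l m"
    using binomial_symmetric[of "l - 2" "l + m - 4"] assms unfolding fES_def
    by (simp add: add.commute)
  then have card: "card X = fES l m"
    unfolding X_def using Y(2) by (simp add: card_image inj_flip)
  have "int ((l + m - 6) choose (m - 3)) - int l + 1 < int (points_inside X C)"
    if C: "C \<subseteq> X" "is_cap m C" for C
  proof -
    have C': "flip ` C \<subseteq> Y" "cup (flip ` C)" "card (flip ` C) = m"
      using is_cap_imp_cap[OF C(2)] C(1) unfolding X_def
      by (auto simp: cup_flip card_image inj_flip)
    obtain W where W: "W \<subseteq> Y" "int ((l + m - 6) choose (m - 3)) - int l + 1 < int (card W)"
      and tri: "\<forall>w\<in>W. \<exists>p\<in>flip ` C. \<exists>q\<in>flip ` C. \<exists>r\<in>flip ` C. in_triangle w p q r"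
      using deep[OF C'] by blast
    have "\<exists>p\<in>C. \<exists>q\<in>C. \<exists>r\<in>C. in_triangle w p q r" if "w \<in> flip ` W" for w
    proof -
      obtain w' where w': "w' \<in> W" "w = flip w'" using \<open>w \<in> flip ` W\<close> by blast
      then obtain p q r where "p \<in> C" "q \<in> C" "r \<in> C" "in_triangle w' (flip p) (flip q) (flip r)"
        using tri by blast
      then show ?thesis
        using in_triangle_flip[of w' "flip p" "flip q" "flip r"] w'(2) by (metis flip_flip)
    qed
    then have "card (flip ` W) \<le> points_inside X C"
      using W(1) by (intro points_inside_ge[OF fin]) (auto simp: X_def)
    then show ?thesis
      using W(2) by (simp add: card_image inj_flip)
  qed
  moreover have "\<not> is_cup l C" if "C \<subseteq> X" for C
  proof
    assume "is_cup l C"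
    then have "cap (flip ` C)" "card (flip ` C) = l"
      using is_cup_imp_cup by (auto simp: cap_flip card_image inj_flip)
    moreover have "flip ` C \<subseteq> Y" using that unfolding X_def by auto
    ultimately have "l \<le> l - 1" using Y(3) unfolding caps_le_def by metis
    then show False using assms by linarith
  qed
  ultimately have "avoids X l m (int a) (int ((l + m - 6) choose (m - 3)) - int l + 1)"
    unfolding avoids_def by (meson not_less)
  then show ?thesis
    using gX card generic_imp_admissible by (metis order_refl)
qed

theorem mainTheorem6:
  fixes l m a :: nat
  assumes "l \<ge> 4" and "m \<ge> 4"
  shows "(int ((l + m - 6) choose (l - 3)) - int m + 1 \<ge> 0 \<longrightarrow>
           (\<exists>X. admissible X \<and> card X \<ge> fES l m \<and>
                avoids X l m (int ((l + m - 6) choose (l - 3)) - int m + 1) (int a)))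
       \<and> (int ((l + m - 6) choose (m - 3)) - int l + 1 \<ge> 0 \<longrightarrow>
           (\<exists>X. admissible X \<and> card X \<ge> fES l m \<and>
                avoids X l m (int a) (int ((l + m - 6) choose (m - 3)) - int l + 1)))"
  using exists_avoiding_deep_cups[OF assms] exists_avoiding_deep_caps[OF assms] by blast

end
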